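(* There is a natural one-to-one correspondence between the subdirect products $\Delta \leq G_1\times G_2\times G_3$ which are 2-factor injective and satisfy $\Delta = H$, and the tuples of the form $(B_1,B_2,B_3,C_1,C_2,C_3,\varphi_1,\varphi_2,\varphi_3)$ for which for all $i\in \{1,2,3\}$ (indices taken modulo 3) we have 1. $B_i,C_i \trianglelefteq G_i$, 2. $B_iC_i = G_i$, 3. $B_i$ and $C_{i+1}$ are isomorphic via the isomorphism $\varphi_i\colon B_i\to C_{i+1}$, 4. $[B_i, C_i]= 1$, 5. $\varphi_i(B_i\cap C_i) = B_{i+1}\cap C_{i+1}$, 6. $\varphi_3|_{B_3\cap C_3}\circ\varphi_2|_{B_2\cap C_2}\circ \varphi_1|_{B_1\cap C_1} = \mathrm{id}$.
   Context: $G_1,G_2,G_3$ are groups. For a subgroup $\Delta\leq G_1\times G_2\times G_3$, $\pi_i$ is the projection to the $i$-th coordinate and $\psi_i$ is the homomorphism on $\Delta$ deleting the $i$-th coordinate. $\Delta$ is a subdirect product if $\pi_i(\Delta)=G_i$ for all $i\in\{1,2,3\}$; it is 2-factor injective if $\psi_1,\psi_2,\psi_3$ are all injective. For such $\Delta$ put $H_i=\{(g_1,g_2,g_3)\in\Delta\mid g_i=1\}$ for $i\in\{1,2,3\}$, and $H=\langle H_1,H_2,H_3\rangle$, which is a normal subgroup of $\Delta$. $[B,C]=1$ means that every element of $B$ commutes with every element of $C$.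
   Formalization: Condition 6 is corrected: the composite φ3∘φ2∘φ1 on B1∩C1 is required to be inversion x ↦ x^{-1} instead of id; with id the claim fails, e.g. for all G_i the central product of two copies of Z7⋊Z9 (centre of order 3), where tuples exist but no Δ does. *)

theory Defs
  imports "HOL-Algebra.Algebra"
begin

text \<open>
  An element of \<open>G1 \<times>\<times> G2 \<times>\<times> G3\<close> is a right-nested triple \<open>(x, y, z)\<close>.
\<close>

definition subdirect_product3 ::
  "('a, 'm) monoid_scheme \<Rightarrow> ('b, 'n) monoid_scheme \<Rightarrow> ('c, 'k) monoid_scheme
    \<Rightarrow> ('a \<times> 'b \<times> 'c) set \<Rightarrow> bool" where
  "subdirect_product3 G1 G2 G3 \<Delta> \<longleftrightarrow>
     subgroup \<Delta> (G1 \<times>\<times> G2 \<times>\<times> G3) \<and>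
     (\<lambda>(x, y, z). x) ` \<Delta> = carrier G1 \<and>
     (\<lambda>(x, y, z). y) ` \<Delta> = carrier G2 \<and>
     (\<lambda>(x, y, z). z) ` \<Delta> = carrier G3"

definition two_factor_injective :: "('a \<times> 'b \<times> 'c) set \<Rightarrow> bool" where
  "two_factor_injective \<Delta> \<longleftrightarrow>
     inj_on (\<lambda>(x, y, z). (y, z)) \<Delta> \<and>
     inj_on (\<lambda>(x, y, z). (x, z)) \<Delta> \<and>
     inj_on (\<lambda>(x, y, z). (x, y)) \<Delta>"

definition H1 :: "('a, 'm) monoid_scheme \<Rightarrow> ('a \<times> 'b \<times> 'c) set \<Rightarrow> ('a \<times> 'b \<times> 'c) set" where
  "H1 G1 \<Delta> = {(x, y, z). (x, y, z) \<in> \<Delta> \<and> x = \<one>\<^bsub>G1\<^esub>}"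

definition H2 :: "('b, 'n) monoid_scheme \<Rightarrow> ('a \<times> 'b \<times> 'c) set \<Rightarrow> ('a \<times> 'b \<times> 'c) set" where
  "H2 G2 \<Delta> = {(x, y, z). (x, y, z) \<in> \<Delta> \<and> y = \<one>\<^bsub>G2\<^esub>}"

definition H3 :: "('c, 'k) monoid_scheme \<Rightarrow> ('a \<times> 'b \<times> 'c) set \<Rightarrow> ('a \<times> 'b \<times> 'c) set" where
  "H3 G3 \<Delta> = {(x, y, z). (x, y, z) \<in> \<Delta> \<and> z = \<one>\<^bsub>G3\<^esub>}"

definition H_gen ::
  "('a, 'm) monoid_scheme \<Rightarrow> ('b, 'n) monoid_scheme \<Rightarrow> ('c, 'k) monoid_scheme
    \<Rightarrow> ('a \<times> 'b \<times> 'c) set \<Rightarrow> ('a \<times> 'b \<times> 'c) set" where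
  "H_gen G1 G2 G3 \<Delta> = generate (G1 \<times>\<times> G2 \<times>\<times> G3) (H1 G1 \<Delta> \<union> H2 G2 \<Delta> \<union> H3 G3 \<Delta>)"

definition H_subdirect_products ::
  "('a, 'm) monoid_scheme \<Rightarrow> ('b, 'n) monoid_scheme \<Rightarrow> ('c, 'k) monoid_scheme
    \<Rightarrow> ('a \<times> 'b \<times> 'c) set set" where
  "H_subdirect_products G1 G2 G3 =
     {\<Delta>. subdirect_product3 G1 G2 G3 \<Delta> \<and> two_factor_injective \<Delta> \<and> \<Delta> = H_gen G1 G2 G3 \<Delta>}"

type_synonym ('a, 'b, 'c) gluing_data =
  "'a set \<times> 'b set \<times> 'c set \<times> 'a set \<times> 'b set \<times> 'c set \<times> ('a \<Rightarrow> 'b) \<times> ('b \<Rightarrow> 'c) \<times> ('c \<Rightarrow> 'a)"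

definition central_factorization ::
  "('a, 'm) monoid_scheme \<Rightarrow> 'a set \<Rightarrow> 'a set \<Rightarrow> bool" where
  "central_factorization G B C \<longleftrightarrow>
     B \<lhd> G \<and> C \<lhd> G \<and> B <#>\<^bsub>G\<^esub> C = carrier G \<and>
     (\<forall>b\<in>B. \<forall>c\<in>C. b \<otimes>\<^bsub>G\<^esub> c = c \<otimes>\<^bsub>G\<^esub> b)"

text \<open>
  A map with domain \<open>B\<close> is represented by a total function that is \<open>undefined\<close> outside \<open>B\<close>,
  so that equality of such functions is equality of maps on \<open>B\<close>.
\<close>

definition subgroup_iso ::
  "('a, 'm) monoid_scheme \<Rightarrow> 'a set \<Rightarrow> ('b, 'n) monoid_scheme \<Rightarrow> 'b set \<Rightarrow> ('a \<Rightarrow> 'b) \<Rightarrow> bool" where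
  "subgroup_iso G B G' C' \<phi> \<longleftrightarrow>
     \<phi> \<in> iso (G\<lparr>carrier := B\<rparr>) (G'\<lparr>carrier := C'\<rparr>) \<and> \<phi> \<in> extensional B"

text \<open>
  The composite in the last condition is inversion on the central subgroup \<open>B1 \<inter> C1\<close>. The
  published condition has the identity there, which is a sign error: for \<open>x \<in> B1 \<inter> C1\<close> a group
  \<open>\<Delta>\<close> as above contains \<open>(x, y, 1)\<close> and \<open>(x, 1, z)\<close> with \<open>y = \<phi>1 x\<close> and \<open>\<phi>3 z = x\<close>, hence it
  contains \<open>(1, y, inv z)\<close>, so \<open>\<phi>2 y = inv z\<close> and \<open>\<phi>3 (\<phi>2 (\<phi>1 x)) = inv x\<close>.
  With the identity the two sets need not even be equinumerous: for \<open>P = Z7 : Z9\<close> of order 63 with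
  centre of order 3, and all three groups equal to the central product of two copies of \<open>P\<close>
  over the centre, there are tuples of that kind, but no such \<open>\<Delta>\<close>.
\<close>

definition gluing_tuples ::
  "('a, 'm) monoid_scheme \<Rightarrow> ('b, 'n) monoid_scheme \<Rightarrow> ('c, 'k) monoid_scheme
    \<Rightarrow> ('a, 'b, 'c) gluing_data set" where
  "gluing_tuples G1 G2 G3 =
     {(B1, B2, B3, C1, C2, C3, \<phi>1, \<phi>2, \<phi>3).
        central_factorization G1 B1 C1 \<and>
        central_factorization G2 B2 C2 \<and>
        central_factorization G3 B3 C3 \<and>
        subgroup_iso G1 B1 G2 C2 \<phi>1 \<and>
        subgroup_iso G2 B2 G3 C3 \<phi>2 \<and>
        subgroup_iso G3 B3 G1 C1 \<phi>3 \<and>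
        \<phi>1 ` (B1 \<inter> C1) = B2 \<inter> C2 \<and>
        \<phi>2 ` (B2 \<inter> C2) = B3 \<inter> C3 \<and>
        \<phi>3 ` (B3 \<inter> C3) = B1 \<inter> C1 \<and>
        (\<forall>x\<in>B1 \<inter> C1. \<phi>3 (\<phi>2 (\<phi>1 x)) = inv\<^bsub>G1\<^esub> x)}"

text \<open>
  The natural correspondence: with indices modulo 3, \<open>H\<^sub>i\<^sub>+\<^sub>2\<close> is the graph of an isomorphism
  \<open>\<phi>\<^sub>i\<close> from its projection \<open>B\<^sub>i\<close> to the \<open>i\<close>-th coordinate onto its projection \<open>C\<^sub>i\<^sub>+\<^sub>1\<close> to
  the \<open>(i+1)\<close>-st coordinate.
\<close>

definition gluing_data_of ::
  "('a, 'm) monoid_scheme \<Rightarrow> ('b, 'n) monoid_scheme \<Rightarrow> ('c, 'k) monoid_scheme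
    \<Rightarrow> ('a \<times> 'b \<times> 'c) set \<Rightarrow> ('a, 'b, 'c) gluing_data" where
  "gluing_data_of G1 G2 G3 \<Delta> =
     (let B1 = (\<lambda>(x, y, z). x) ` H3 G3 \<Delta>;
          B2 = (\<lambda>(x, y, z). y) ` H1 G1 \<Delta>;
          B3 = (\<lambda>(x, y, z). z) ` H2 G2 \<Delta>;
          C1 = (\<lambda>(x, y, z). x) ` H2 G2 \<Delta>;
          C2 = (\<lambda>(x, y, z). y) ` H3 G3 \<Delta>;
          C3 = (\<lambda>(x, y, z). z) ` H1 G1 \<Delta>
      in (B1, B2, B3, C1, C2, C3,
          (\<lambda>b\<in>B1. THE c. (b, c, \<one>\<^bsub>G3\<^esub>) \<in> \<Delta>),
          (\<lambda>b\<in>B2. THE c. (\<one>\<^bsub>G1\<^esub>, b, c) \<in> \<Delta>),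
          (\<lambda>b\<in>B3. THE c. (c, \<one>\<^bsub>G2\<^esub>, b) \<in> \<Delta>)))"

end

theory Submission
  imports Defs
begin

text \<open>
  For \<open>i \<noteq> j\<close> the commutator of an element of \<open>H\<^sub>i\<close> with one of \<open>H\<^sub>j\<close> has two trivial coordinates,
  so 2-factor injectivity makes \<open>H\<^sub>i\<close> and \<open>H\<^sub>j\<close> commute. Each \<open>H\<^sub>i\<close> is the graph of an isomorphism,
  and a product of one element from each of the three graphs is the general element of \<open>H\<close>.
  Conversely, a tuple yields the group of all
  \<open>(a \<cdot> \<phi>\<^sub>3 c, b \<cdot> \<phi>\<^sub>1 a, c \<cdot> \<phi>\<^sub>2 b)\<close>; the condition on \<open>\<phi>\<^sub>3 \<circ> \<phi>\<^sub>2 \<circ> \<phi>\<^sub>1\<close> ensures that its elements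
  with trivial third coordinate are just the graph of \<open>\<phi>\<^sub>1\<close>. Everything is invariant under rotating
  the three factors, so one index suffices.
\<close>

section \<open>Rotating the coordinates, and the relations cut out by a trivial coordinate\<close>

definition rotate3 :: "('a \<times> 'b \<times> 'c) set \<Rightarrow> ('b \<times> 'c \<times> 'a) set" where
  "rotate3 \<Delta> = {(y, z, x). (x, y, z) \<in> \<Delta>}"

lemma mem_rotate3 [simp]: "(y, z, x) \<in> rotate3 \<Delta> \<longleftrightarrow> (x, y, z) \<in> \<Delta>"
  by (simp add: rotate3_def)

lemma rotate3_rotate3_rotate3 [simp]: "rotate3 (rotate3 (rotate3 \<Delta>)) = \<Delta>"
  by (auto simp: rotate3_def)

text \<open>For \<open>G = G3\<close> this is \<open>H3\<close> with its constant last coordinate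
  dropped. The other two subgroups are reached by rotating \<Delta> first, so that one definition
  serves all three.\<close>

definition edge :: "('c, 'k) monoid_scheme \<Rightarrow> ('a \<times> 'b \<times> 'c) set \<Rightarrow> ('a \<times> 'b) set" where
  "edge G \<Delta> = {(x, y). (x, y, \<one>\<^bsub>G\<^esub>) \<in> \<Delta>}"

lemma mem_edge [simp]: "(x, y) \<in> edge G \<Delta> \<longleftrightarrow> (x, y, \<one>\<^bsub>G\<^esub>) \<in> \<Delta>"
  by (simp add: edge_def)

text \<open>Has the shape of the maps in \<open>gluing_data_of\<close>, restriction included, so
  that the equality of tuples later is literal. It is meaningful once \<open>E\<close> is
  single-valued.\<close>

definition graph_map :: "('a \<times> 'b) set \<Rightarrow> 'a \<Rightarrow> 'b" where
  "graph_map E = (\<lambda>b\<in>Domain E. THE c. (b, c) \<in> E)"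

text \<open>Puts the correspondence into a form that rotation permutes: the \<open>B\<close>s are
  the domains of the three edges, the \<open>C\<close>s the ranges shifted by one index, so
  \<open>C1\<close> belongs to the third edge.\<close>

lemma gluing_data_of_edge:
  "gluing_data_of G1 G2 G3 \<Delta> =
     (let E1 = edge G3 \<Delta>; E2 = edge G1 (rotate3 \<Delta>); E3 = edge G2 (rotate3 (rotate3 \<Delta>))
      in (Domain E1, Domain E2, Domain E3, Range E3, Range E1, Range E2,
          graph_map E1, graph_map E2, graph_map E3))"
proof -
  have "(\<lambda>(x, y, z). x) ` H3 G3 \<Delta> = Domain (edge G3 \<Delta>)"
    "(\<lambda>(x, y, z). y) ` H3 G3 \<Delta> = Range (edge G3 \<Delta>)"
    "(\<lambda>(x, y, z). y) ` H1 G1 \<Delta> = Domain (edge G1 (rotate3 \<Delta>))"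
    "(\<lambda>(x, y, z). z) ` H1 G1 \<Delta> = Range (edge G1 (rotate3 \<Delta>))"
    "(\<lambda>(x, y, z). z) ` H2 G2 \<Delta> = Domain (edge G2 (rotate3 (rotate3 \<Delta>)))"
    "(\<lambda>(x, y, z). x) ` H2 G2 \<Delta> = Range (edge G2 (rotate3 (rotate3 \<Delta>)))"
    by (force simp: H1_def H2_def H3_def)+
  then show ?thesis
    by (simp add: gluing_data_of_def graph_map_def Let_def)
qed

section \<open>2-factor injective subgroups, described coordinate by coordinate\<close>

locale slim_triple = G1: group G1 + G2: group G2 + G3: group G3
  for G1 :: "('a, 'm) monoid_scheme" and G2 :: "('b, 'n) monoid_scheme"
    and G3 :: "('c, 'k) monoid_scheme" +
  fixes \<Delta> :: "('a \<times> 'b \<times> 'c) set"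
  assumes carr: "(x, y, z) \<in> \<Delta> \<Longrightarrow> x \<in> carrier G1 \<and> y \<in> carrier G2 \<and> z \<in> carrier G3"
    and one: "(\<one>\<^bsub>G1\<^esub>, \<one>\<^bsub>G2\<^esub>, \<one>\<^bsub>G3\<^esub>) \<in> \<Delta>"
    and mult: "\<lbrakk>(x, y, z) \<in> \<Delta>; (x', y', z') \<in> \<Delta>\<rbrakk>
      \<Longrightarrow> (x \<otimes>\<^bsub>G1\<^esub> x', y \<otimes>\<^bsub>G2\<^esub> y', z \<otimes>\<^bsub>G3\<^esub> z') \<in> \<Delta>"
    and minv: "(x, y, z) \<in> \<Delta> \<Longrightarrow> (inv\<^bsub>G1\<^esub> x, inv\<^bsub>G2\<^esub> y, inv\<^bsub>G3\<^esub> z) \<in> \<Delta>"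
    and inj1: "\<lbrakk>(x, y, z) \<in> \<Delta>; (x', y, z) \<in> \<Delta>\<rbrakk> \<Longrightarrow> x = x'"
    and inj2: "\<lbrakk>(x, y, z) \<in> \<Delta>; (x, y', z) \<in> \<Delta>\<rbrakk> \<Longrightarrow> y = y'"
    and inj3: "\<lbrakk>(x, y, z) \<in> \<Delta>; (x, y, z') \<in> \<Delta>\<rbrakk> \<Longrightarrow> z = z'"

text \<open>In the coordinatewise form, rotating the factors merely permutes the conditions, whereas
  \<open>G1 \<times>\<times> G2 \<times>\<times> G3\<close> has a nesting that rotation does not
  respect.\<close>

lemma slim_triple_iff:
  assumes "group G1" "group G2" "group G3"
  shows "slim_triple G1 G2 G3 \<Delta> \<longleftrightarrow>
    subgroup \<Delta> (G1 \<times>\<times> G2 \<times>\<times> G3) \<and> two_factor_injective \<Delta>" (is "?L \<longleftrightarrow> ?R")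
proof -
  note gr = assms DirProd_group[OF assms(2,3)] DirProd_group[OF assms(1) DirProd_group[OF assms(2,3)]]
  show ?thesis
  proof
    assume ?L
    then interpret slim_triple G1 G2 G3 \<Delta> .
    have "subgroup \<Delta> (G1 \<times>\<times> G2 \<times>\<times> G3)"
    proof (rule group.subgroupI[OF gr(5)])
      show "\<Delta> \<noteq> {}" using one by blast
      show "inv\<^bsub>G1 \<times>\<times> G2 \<times>\<times> G3\<^esub> p \<in> \<Delta>" if "p \<in> \<Delta>" for p
        using minv carr that by (cases p) (simp add: inv_DirProd gr)
      show "p \<otimes>\<^bsub>G1 \<times>\<times> G2 \<times>\<times> G3\<^esub> q \<in> \<Delta>" if "p \<in> \<Delta>" "q \<in> \<Delta>" for p q
        using mult that by (cases p; cases q) simp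
    qed (auto dest: carr)
    moreover have "two_factor_injective \<Delta>"
      unfolding two_factor_injective_def
      by (intro conjI inj_onI; clarsimp) (erule (1) inj1 inj2 inj3)+
    ultimately show ?R by simp
  next
    assume R: ?R
    then have s: "subgroup \<Delta> (G1 \<times>\<times> G2 \<times>\<times> G3)" and t: "two_factor_injective \<Delta>" by auto
    show ?L
    proof (intro slim_triple.intro slim_triple_axioms.intro assms)
      show carr: "x \<in> carrier G1 \<and> y \<in> carrier G2 \<and> z \<in> carrier G3" if "(x, y, z) \<in> \<Delta>" for x y z
        using subgroup.mem_carrier[OF s that] by simp
      show "(\<one>\<^bsub>G1\<^esub>, \<one>\<^bsub>G2\<^esub>, \<one>\<^bsub>G3\<^esub>) \<in> \<Delta>"
        using subgroup.one_closed[OF s] by simp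
      show "(x \<otimes>\<^bsub>G1\<^esub> x', y \<otimes>\<^bsub>G2\<^esub> y', z \<otimes>\<^bsub>G3\<^esub> z') \<in> \<Delta>"
        if "(x, y, z) \<in> \<Delta>" "(x', y', z') \<in> \<Delta>" for x y z x' y' z'
        using subgroup.m_closed[OF s that] by simp
      show "(inv\<^bsub>G1\<^esub> x, inv\<^bsub>G2\<^esub> y, inv\<^bsub>G3\<^esub> z) \<in> \<Delta>" if "(x, y, z) \<in> \<Delta>" for x y z
        using subgroup.m_inv_closed[OF s that] carr[OF that] by (simp add: inv_DirProd gr)
      show "x = x'" if "(x, y, z) \<in> \<Delta>" "(x', y, z) \<in> \<Delta>" for x y z x'
        using inj_onD[of "\<lambda>(x, y, z). (y, z)" \<Delta> "(x, y, z)" "(x', y, z)"] t that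
        by (simp add: two_factor_injective_def)
      show "y = y'" if "(x, y, z) \<in> \<Delta>" "(x, y', z) \<in> \<Delta>" for x y z y'
        using inj_onD[of "\<lambda>(x, y, z). (x, z)" \<Delta> "(x, y, z)" "(x, y', z)"] t that
        by (simp add: two_factor_injective_def)
      show "z = z'" if "(x, y, z) \<in> \<Delta>" "(x, y, z') \<in> \<Delta>" for x y z z'
        using inj_onD[of "\<lambda>(x, y, z). (x, y)" \<Delta> "(x, y, z)" "(x, y, z')"] t that
        by (simp add: two_factor_injective_def)
    qed
  qed
qed

section \<open>The subgroup generated by the three edges as an explicit set of products\<close>

definition edges_factor ::
  "('a, 'm) monoid_scheme \<Rightarrow> ('b, 'n) monoid_scheme \<Rightarrow> ('c, 'k) monoid_scheme
    \<Rightarrow> ('a \<times> 'b \<times> 'c) set \<Rightarrow> ('a \<times> 'b \<times> 'c) set" where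
  "edges_factor G1 G2 G3 \<Delta> = {(a \<otimes>\<^bsub>G1\<^esub> c', b \<otimes>\<^bsub>G2\<^esub> a', c \<otimes>\<^bsub>G3\<^esub> b') | a a' b b' c c'.
     (a, a', \<one>\<^bsub>G3\<^esub>) \<in> \<Delta> \<and> (\<one>\<^bsub>G1\<^esub>, b, b') \<in> \<Delta> \<and> (c', \<one>\<^bsub>G2\<^esub>, c) \<in> \<Delta>}"

lemma edges_factorI:
  assumes "(a, a', \<one>\<^bsub>G3\<^esub>) \<in> \<Delta>" "(\<one>\<^bsub>G1\<^esub>, b, b') \<in> \<Delta>" "(c', \<one>\<^bsub>G2\<^esub>, c) \<in> \<Delta>"
    and "x = a \<otimes>\<^bsub>G1\<^esub> c'" "y = b \<otimes>\<^bsub>G2\<^esub> a'" "z = c \<otimes>\<^bsub>G3\<^esub> b'"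
  shows "(x, y, z) \<in> edges_factor G1 G2 G3 \<Delta>"
  using assms unfolding edges_factor_def by blast

text \<open>In every coordinate the entry from the domain of an edge stands left of the entry from a
  range. This cyclic pattern is what rotation preserves; no linear order of the three factors
  produces it literally.\<close>

lemma rotate3_edges_factor:
  "rotate3 (edges_factor G1 G2 G3 \<Delta>) = edges_factor G2 G3 G1 (rotate3 \<Delta>)"
proof
  show "rotate3 (edges_factor G1 G2 G3 \<Delta>) \<subseteq> edges_factor G2 G3 G1 (rotate3 \<Delta>)"
  proof
    fix p assume p: "p \<in> rotate3 (edges_factor G1 G2 G3 \<Delta>)"
    obtain y z x where p_eq: "p = (y, z, x)" by (cases p)
    with p have "(x, y, z) \<in> edges_factor G1 G2 G3 \<Delta>" by simp
    then obtain a a' b b' c c' where "x = a \<otimes>\<^bsub>G1\<^esub> c'" "y = b \<otimes>\<^bsub>G2\<^esub> a'" "z = c \<otimes>\<^bsub>G3\<^esub> b'"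
      "(a, a', \<one>\<^bsub>G3\<^esub>) \<in> \<Delta>" "(\<one>\<^bsub>G1\<^esub>, b, b') \<in> \<Delta>" "(c', \<one>\<^bsub>G2\<^esub>, c) \<in> \<Delta>"
      unfolding edges_factor_def by blast
    then show "p \<in> edges_factor G2 G3 G1 (rotate3 \<Delta>)"
      unfolding p_eq
      by (intro edges_factorI[where a = b and a' = b' and b = c and b' = c' and c = a and c' = a']) simp_all
  qed
  show "edges_factor G2 G3 G1 (rotate3 \<Delta>) \<subseteq> rotate3 (edges_factor G1 G2 G3 \<Delta>)"
  proof
    fix p assume p: "p \<in> edges_factor G2 G3 G1 (rotate3 \<Delta>)"
    then obtain a a' b b' c c' where p_eq: "p = (a \<otimes>\<^bsub>G2\<^esub> c', b \<otimes>\<^bsub>G3\<^esub> a', c \<otimes>\<^bsub>G1\<^esub> b')"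
      and "(a, a', \<one>\<^bsub>G1\<^esub>) \<in> rotate3 \<Delta>" "(\<one>\<^bsub>G2\<^esub>, b, b') \<in> rotate3 \<Delta>" "(c', \<one>\<^bsub>G3\<^esub>, c) \<in> rotate3 \<Delta>"
      unfolding edges_factor_def by blast
    then show "p \<in> rotate3 (edges_factor G1 G2 G3 \<Delta>)"
      unfolding p_eq mem_rotate3
      by (intro edges_factorI[where a = c and a' = c' and b = a and b' = a' and c = b and c' = b']) simp_all
  qed
qed

context slim_triple
begin

lemma rotated: "slim_triple G2 G3 G1 (rotate3 \<Delta>)"
  by unfold_locales
    (unfold mem_rotate3, blast dest: carr,
      (rule one | erule (1) mult | erule minv | erule (1) inj1 inj2 inj3)+)

text \<open>The two products of \<open>(a, a', 1)\<close> and \<open>(c', 1, c)\<close> are both in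
  \<Delta> and agree in the last two coordinates, so \<open>inj1\<close> equates the first
  ones.\<close>

lemma edges_commute:
  assumes "(a, a', \<one>\<^bsub>G3\<^esub>) \<in> \<Delta>" "(c', \<one>\<^bsub>G2\<^esub>, c) \<in> \<Delta>"
  shows "a \<otimes>\<^bsub>G1\<^esub> c' = c' \<otimes>\<^bsub>G1\<^esub> a"
  using inj1[of "a \<otimes>\<^bsub>G1\<^esub> c'" a' c "c' \<otimes>\<^bsub>G1\<^esub> a"] mult[OF assms] mult[OF assms(2,1)]
    carr[OF assms(1)] carr[OF assms(2)] by simp

end

context slim_triple
begin

interpretation R: slim_triple G2 G3 G1 "rotate3 \<Delta>" by (rule rotated)
interpretation RR: slim_triple G3 G1 G2 "rotate3 (rotate3 \<Delta>)" by (rule R.rotated)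

lemma H_gen_eq_edges_factor: "H_gen G1 G2 G3 \<Delta> = edges_factor G1 G2 G3 \<Delta>"
proof
  \<comment> \<open>An interchange law that needs only the two middle factors to commute. The group
    is arbitrary because all three coordinates use it.\<close>
  have swap: "(p \<otimes>\<^bsub>K\<^esub> q) \<otimes>\<^bsub>K\<^esub> (r \<otimes>\<^bsub>K\<^esub> s) = (p \<otimes>\<^bsub>K\<^esub> r) \<otimes>\<^bsub>K\<^esub> (q \<otimes>\<^bsub>K\<^esub> s)"
    if "group K" "q \<otimes>\<^bsub>K\<^esub> r = r \<otimes>\<^bsub>K\<^esub> q" "p \<in> carrier K" "q \<in> carrier K" "r \<in> carrier K" "s \<in> carrier K"
    for p q r s and K :: "('x, 'y) monoid_scheme"
  proof -
    interpret group K by fact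
    have "(p \<otimes>\<^bsub>K\<^esub> q) \<otimes>\<^bsub>K\<^esub> (r \<otimes>\<^bsub>K\<^esub> s) = p \<otimes>\<^bsub>K\<^esub> (q \<otimes>\<^bsub>K\<^esub> r) \<otimes>\<^bsub>K\<^esub> s"
      using that(3-) by (simp add: m_assoc)
    also have "\<dots> = (p \<otimes>\<^bsub>K\<^esub> r) \<otimes>\<^bsub>K\<^esub> (q \<otimes>\<^bsub>K\<^esub> s)"
      unfolding that(2) using that(3-) by (simp add: m_assoc)
    finally show ?thesis .
  qed
  have H_le: "h \<in> edges_factor G1 G2 G3 \<Delta>" if "h \<in> H1 G1 \<Delta> \<union> H2 G2 \<Delta> \<union> H3 G3 \<Delta>" for h
  proof -
    obtain x y z where "h = (x, y, z)" by (cases h)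
    with that consider "h = (\<one>\<^bsub>G1\<^esub>, y, z)" "(\<one>\<^bsub>G1\<^esub>, y, z) \<in> \<Delta>"
      | "h = (x, \<one>\<^bsub>G2\<^esub>, z)" "(x, \<one>\<^bsub>G2\<^esub>, z) \<in> \<Delta>" | "h = (x, y, \<one>\<^bsub>G3\<^esub>)" "(x, y, \<one>\<^bsub>G3\<^esub>) \<in> \<Delta>"
      by (auto simp: H1_def H2_def H3_def)
    then show ?thesis
    proof cases
      case 1
      then show ?thesis
        using edges_factorI[OF one 1(2) one refl refl refl] carr[OF 1(2)] by simp
    next
      case 2
      then show ?thesis
        using edges_factorI[OF one one 2(2) refl refl refl] carr[OF 2(2)] by simp
    next
      case 3
      then show ?thesis
        using edges_factorI[OF 3(2) one one refl refl refl] carr[OF 3(2)] by simp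
    qed
  qed
  \<comment> \<open>\<open>generate\<close> treats inverses of generators as a separate case; the
    union of \<open>H1\<close>, \<open>H2\<close> and \<open>H3\<close> is already closed under
    them.\<close>
  have H_inv: "inv\<^bsub>G1 \<times>\<times> G2 \<times>\<times> G3\<^esub> h \<in> H1 G1 \<Delta> \<union> H2 G2 \<Delta> \<union> H3 G3 \<Delta>"
    if "h \<in> H1 G1 \<Delta> \<union> H2 G2 \<Delta> \<union> H3 G3 \<Delta>" for h
  proof -
    obtain x y z where h: "h = (x, y, z)" by (cases h)
    with that have "(x, y, z) \<in> \<Delta>" by (auto simp: H1_def H2_def H3_def)
    with minv[OF this] carr[OF this] that show ?thesis
      by (auto simp: h inv_DirProd DirProd_group H1_def H2_def H3_def)
  qed
  show "H_gen G1 G2 G3 \<Delta> \<subseteq> edges_factor G1 G2 G3 \<Delta>"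
  proof
    fix p assume "p \<in> H_gen G1 G2 G3 \<Delta>"
    then show "p \<in> edges_factor G1 G2 G3 \<Delta>"
      unfolding H_gen_def
    proof (induction p rule: generate.induct)
      case one
      show ?case
        using H_le slim_triple.one[OF slim_triple_axioms] by (simp add: H1_def)
    next
      case (incl h)
      then show ?case by (rule H_le)
    next
      case (inv h)
      then have "inv\<^bsub>G1 \<times>\<times> G2 \<times>\<times> G3\<^esub> h \<in> H1 G1 \<Delta> \<union> H2 G2 \<Delta> \<union> H3 G3 \<Delta>"
        by (rule H_inv)
      then show ?case by (rule H_le)
    next
      case (eng h1 h2)
      obtain a a' b b' c c' where h1: "h1 = (a \<otimes>\<^bsub>G1\<^esub> c', b \<otimes>\<^bsub>G2\<^esub> a', c \<otimes>\<^bsub>G3\<^esub> b')"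
        and e: "(a, a', \<one>\<^bsub>G3\<^esub>) \<in> \<Delta>" "(\<one>\<^bsub>G1\<^esub>, b, b') \<in> \<Delta>" "(c', \<one>\<^bsub>G2\<^esub>, c) \<in> \<Delta>"
        using eng.IH(1) unfolding edges_factor_def by blast
      obtain r r' s s' t t' where h2: "h2 = (r \<otimes>\<^bsub>G1\<^esub> t', s \<otimes>\<^bsub>G2\<^esub> r', t \<otimes>\<^bsub>G3\<^esub> s')"
        and f: "(r, r', \<one>\<^bsub>G3\<^esub>) \<in> \<Delta>" "(\<one>\<^bsub>G1\<^esub>, s, s') \<in> \<Delta>" "(t', \<one>\<^bsub>G2\<^esub>, t) \<in> \<Delta>"
        using eng.IH(2) unfolding edges_factor_def by blast
      note cr = carr[OF e(1)] carr[OF e(2)] carr[OF e(3)] carr[OF f(1)] carr[OF f(2)] carr[OF f(3)]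
      \<comment> \<open>Closure under products: in each coordinate the range entry of
        \<open>h1\<close> moves past the domain entry of \<open>h2\<close>, which
        \<open>edges_commute\<close> and its two rotations permit.\<close>
      have "h1 \<otimes>\<^bsub>G1 \<times>\<times> G2 \<times>\<times> G3\<^esub> h2 = (a \<otimes>\<^bsub>G1\<^esub> r \<otimes>\<^bsub>G1\<^esub> (c' \<otimes>\<^bsub>G1\<^esub> t'),
          b \<otimes>\<^bsub>G2\<^esub> s \<otimes>\<^bsub>G2\<^esub> (a' \<otimes>\<^bsub>G2\<^esub> r'), c \<otimes>\<^bsub>G3\<^esub> t \<otimes>\<^bsub>G3\<^esub> (b' \<otimes>\<^bsub>G3\<^esub> s'))"
        using swap[OF G1.group_axioms edges_commute[OF f(1) e(3), symmetric], of a t']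
          swap[OF G2.group_axioms R.edges_commute[of s s' a' a, symmetric], of b r']
          swap[OF G3.group_axioms RR.edges_commute[of t t' b' b, symmetric], of c s'] e f cr
        by (simp add: h1 h2)
      then show ?case
        using edges_factorI[OF _ _ _ refl refl refl] mult[OF e(1) f(1)] mult[OF e(2) f(2)] mult[OF e(3) f(3)]
        by simp
    qed
  qed
  show "edges_factor G1 G2 G3 \<Delta> \<subseteq> H_gen G1 G2 G3 \<Delta>"
  proof
    fix p assume "p \<in> edges_factor G1 G2 G3 \<Delta>"
    then obtain a a' b b' c c' where p: "p = (a \<otimes>\<^bsub>G1\<^esub> c', b \<otimes>\<^bsub>G2\<^esub> a', c \<otimes>\<^bsub>G3\<^esub> b')"
      and e: "(a, a', \<one>\<^bsub>G3\<^esub>) \<in> \<Delta>" "(\<one>\<^bsub>G1\<^esub>, b, b') \<in> \<Delta>" "(c', \<one>\<^bsub>G2\<^esub>, c) \<in> \<Delta>"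
      unfolding edges_factor_def by blast
    note cr = carr[OF e(1)] carr[OF e(2)] carr[OF e(3)]
    \<comment> \<open>In this order the first two coordinates come out as required, but the third
      one as \<open>b'\<close> times \<open>c\<close>; the rotated commutation rule turns it
      round.\<close>
    have "p = ((\<one>\<^bsub>G1\<^esub>, b, b') \<otimes>\<^bsub>G1 \<times>\<times> G2 \<times>\<times> G3\<^esub> (a, a', \<one>\<^bsub>G3\<^esub>)) \<otimes>\<^bsub>G1 \<times>\<times> G2 \<times>\<times> G3\<^esub> (c', \<one>\<^bsub>G2\<^esub>, c)"
      using p cr RR.edges_commute[of c c' b' b] e by simp
    also have "\<dots> \<in> H_gen G1 G2 G3 \<Delta>"
      unfolding H_gen_def using e
      by (intro generate.eng generate.incl) (auto simp: H1_def H2_def H3_def)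
    finally show "p \<in> H_gen G1 G2 G3 \<Delta>" .
  qed
qed

end

context slim_triple
begin

text \<open>By \<open>inj2\<close> the coordinate \<open>x\<close> determines \<open>y\<close> when
  the third coordinate is trivial, so the definite description has exactly one candidate.\<close>

lemma graph_map_edge: "(x, y, \<one>\<^bsub>G3\<^esub>) \<in> \<Delta> \<Longrightarrow> graph_map (edge G3 \<Delta>) x = y"
  unfolding graph_map_def by (auto intro: inj2)

text \<open>Multiplicativity is closure of \<Delta> under products, injectivity is
  \<open>inj1\<close>, and surjectivity comes from taking the range as codomain.\<close>

lemma edge_iso:
  "subgroup_iso G1 (Domain (edge G3 \<Delta>)) G2 (Range (edge G3 \<Delta>)) (graph_map (edge G3 \<Delta>))"
proof -
  have "graph_map (edge G3 \<Delta>) \<in> hom (G1\<lparr>carrier := Domain (edge G3 \<Delta>)\<rparr>) (G2\<lparr>carrier := Range (edge G3 \<Delta>)\<rparr>)"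
  proof (rule homI)
    fix x y assume "x \<in> carrier (G1\<lparr>carrier := Domain (edge G3 \<Delta>)\<rparr>)" "y \<in> carrier (G1\<lparr>carrier := Domain (edge G3 \<Delta>)\<rparr>)"
    then obtain x' y' where xy: "(x, x', \<one>\<^bsub>G3\<^esub>) \<in> \<Delta>" "(y, y', \<one>\<^bsub>G3\<^esub>) \<in> \<Delta>" by auto
    then have "(x \<otimes>\<^bsub>G1\<^esub> y, x' \<otimes>\<^bsub>G2\<^esub> y', \<one>\<^bsub>G3\<^esub>) \<in> \<Delta>" using mult[OF xy] by simp
    then show "graph_map (edge G3 \<Delta>) (x \<otimes>\<^bsub>G1\<lparr>carrier := Domain (edge G3 \<Delta>)\<rparr>\<^esub> y) =
      graph_map (edge G3 \<Delta>) x \<otimes>\<^bsub>G2\<lparr>carrier := Range (edge G3 \<Delta>)\<rparr>\<^esub> graph_map (edge G3 \<Delta>) y"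
      using xy by (simp add: graph_map_edge)
  qed (auto simp: graph_map_edge)
  moreover have "bij_betw (graph_map (edge G3 \<Delta>)) (Domain (edge G3 \<Delta>)) (Range (edge G3 \<Delta>))"
  proof (rule bij_betw_imageI)
    show "inj_on (graph_map (edge G3 \<Delta>)) (Domain (edge G3 \<Delta>))"
      by (rule inj_onI) (force simp: graph_map_edge intro: inj1)
    show "graph_map (edge G3 \<Delta>) ` Domain (edge G3 \<Delta>) = Range (edge G3 \<Delta>)"
      by (force simp: graph_map_edge)
  qed
  ultimately show ?thesis
    unfolding subgroup_iso_def iso_def by (simp add: graph_map_def)
qed

end

section \<open>Subdirect products with \<Delta> = H, and the conditions on their tuples\<close>

locale split_triple = slim_triple +
  assumes surj1: "x \<in> carrier G1 \<Longrightarrow> \<exists>y z. (x, y, z) \<in> \<Delta>"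
    and surj2: "y \<in> carrier G2 \<Longrightarrow> \<exists>x z. (x, y, z) \<in> \<Delta>"
    and surj3: "z \<in> carrier G3 \<Longrightarrow> \<exists>x y. (x, y, z) \<in> \<Delta>"
    and factor: "\<Delta> = edges_factor G1 G2 G3 \<Delta>"

text \<open>Here \<open>H_gen\<close> is traded for \<open>edges_factor\<close>, whose behaviour
  under rotation is known.\<close>

lemma H_subdirect_products_iff:
  assumes "group G1" "group G2" "group G3"
  shows "\<Delta> \<in> H_subdirect_products G1 G2 G3 \<longleftrightarrow> split_triple G1 G2 G3 \<Delta>"
proof
  assume "\<Delta> \<in> H_subdirect_products G1 G2 G3"
  then have "subgroup \<Delta> (G1 \<times>\<times> G2 \<times>\<times> G3)" "two_factor_injective \<Delta>"
    and img: "carrier G1 = (\<lambda>(x, y, z). x) ` \<Delta>" "carrier G2 = (\<lambda>(x, y, z). y) ` \<Delta>"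
      "carrier G3 = (\<lambda>(x, y, z). z) ` \<Delta>"
    and gen: "\<Delta> = H_gen G1 G2 G3 \<Delta>"
    unfolding H_subdirect_products_def subdirect_product3_def mem_Collect_eq
    by - (elim conjE, (assumption | rule sym, assumption))+
  then interpret slim_triple G1 G2 G3 \<Delta>
    using slim_triple_iff[OF assms, of \<Delta>] by (elim iffD2, intro conjI)
  show "split_triple G1 G2 G3 \<Delta>"
  proof
    show "\<exists>y z. (x, y, z) \<in> \<Delta>" if "x \<in> carrier G1" for x
      using that unfolding img by auto
    show "\<exists>x z. (x, y, z) \<in> \<Delta>" if "y \<in> carrier G2" for y
      using that unfolding img by auto
    show "\<exists>x y. (x, y, z) \<in> \<Delta>" if "z \<in> carrier G3" for z
      using that unfolding img by auto
    show "\<Delta> = edges_factor G1 G2 G3 \<Delta>"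
      using gen unfolding H_gen_eq_edges_factor .
  qed
next
  assume "split_triple G1 G2 G3 \<Delta>"
  then interpret split_triple G1 G2 G3 \<Delta> .
  have "(\<lambda>(x, y, z). x) ` \<Delta> = {x. \<exists>y z. (x, y, z) \<in> \<Delta>}"
    "(\<lambda>(x, y, z). y) ` \<Delta> = {y. \<exists>x z. (x, y, z) \<in> \<Delta>}"
    "(\<lambda>(x, y, z). z) ` \<Delta> = {z. \<exists>x y. (x, y, z) \<in> \<Delta>}"
    by force+
  moreover have "{x. \<exists>y z. (x, y, z) \<in> \<Delta>} = carrier G1" "{y. \<exists>x z. (x, y, z) \<in> \<Delta>} = carrier G2"
    "{z. \<exists>x y. (x, y, z) \<in> \<Delta>} = carrier G3"
    using surj1 surj2 surj3 by (blast dest: carr)+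
  moreover have "subgroup \<Delta> (G1 \<times>\<times> G2 \<times>\<times> G3)" "two_factor_injective \<Delta>"
    using slim_triple_axioms unfolding slim_triple_iff[OF assms] by simp_all
  moreover have "\<Delta> = H_gen G1 G2 G3 \<Delta>"
    unfolding H_gen_eq_edges_factor by (rule factor)
  ultimately show "\<Delta> \<in> H_subdirect_products G1 G2 G3"
    unfolding H_subdirect_products_def subdirect_product3_def mem_Collect_eq by (intro conjI) (assumption | rule trans, assumption, assumption)+
qed

context split_triple
begin

lemma split_rotated: "split_triple G2 G3 G1 (rotate3 \<Delta>)"
proof -
  interpret slim_triple G2 G3 G1 "rotate3 \<Delta>" by (rule rotated)
  show ?thesis
  proof
    show "rotate3 \<Delta> = edges_factor G2 G3 G1 (rotate3 \<Delta>)"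
      using arg_cong[OF factor, of rotate3] unfolding rotate3_edges_factor .
    show "\<exists>y z. (x, y, z) \<in> rotate3 \<Delta>" if "x \<in> carrier G2" for x
      using surj2[OF that] by auto
    show "\<exists>x z. (x, y, z) \<in> rotate3 \<Delta>" if "y \<in> carrier G3" for y
      using surj3[OF that] by auto
    show "\<exists>x y. (x, y, z) \<in> rotate3 \<Delta>" if "z \<in> carrier G1" for z
      using surj1[OF that] by auto
  qed
qed

text \<open>Conjugation by any element of \<Delta> keeps the third coordinate trivial. As the
  projections are onto, every \<open>x\<close> in \<open>G1\<close>, and likewise every element of
  \<open>G2\<close>, is a coordinate of such a conjugating element.\<close>

lemma normal_Domain_edge: "Domain (edge G3 \<Delta>) \<lhd> G1"
  and normal_Range_edge: "Range (edge G3 \<Delta>) \<lhd> G2"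
proof -
  have conj: "(x \<otimes>\<^bsub>G1\<^esub> h \<otimes>\<^bsub>G1\<^esub> inv\<^bsub>G1\<^esub> x, y \<otimes>\<^bsub>G2\<^esub> h' \<otimes>\<^bsub>G2\<^esub> inv\<^bsub>G2\<^esub> y, \<one>\<^bsub>G3\<^esub>) \<in> \<Delta>"
    if "(x, y, z) \<in> \<Delta>" "(h, h', \<one>\<^bsub>G3\<^esub>) \<in> \<Delta>" for x y z h h'
    using mult[OF mult[OF that] minv[OF that(1)]] carr[OF that(1)] by simp
  have mult1: "(x \<otimes>\<^bsub>G1\<^esub> x', y \<otimes>\<^bsub>G2\<^esub> y', \<one>\<^bsub>G3\<^esub>) \<in> \<Delta>"
    if "(x, y, \<one>\<^bsub>G3\<^esub>) \<in> \<Delta>" "(x', y', \<one>\<^bsub>G3\<^esub>) \<in> \<Delta>" for x y x' y'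
    using mult[OF that] by simp
  have minv1: "(inv\<^bsub>G1\<^esub> x, inv\<^bsub>G2\<^esub> y, \<one>\<^bsub>G3\<^esub>) \<in> \<Delta>" if "(x, y, \<one>\<^bsub>G3\<^esub>) \<in> \<Delta>" for x y
    using minv[OF that] by simp
  have "subgroup (Domain (edge G3 \<Delta>)) G1"
  proof (rule G1.subgroupI)
    show "Domain (edge G3 \<Delta>) \<subseteq> carrier G1"
      using carr by auto
    show "Domain (edge G3 \<Delta>) \<noteq> {}"
      using one by force
    show "inv\<^bsub>G1\<^esub> x \<in> Domain (edge G3 \<Delta>)" if "x \<in> Domain (edge G3 \<Delta>)" for x
      using that minv1 by force
    show "x \<otimes>\<^bsub>G1\<^esub> y \<in> Domain (edge G3 \<Delta>)"
      if "x \<in> Domain (edge G3 \<Delta>)" "y \<in> Domain (edge G3 \<Delta>)" for x y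
      using that mult1 by force
  qed
  moreover have "x \<otimes>\<^bsub>G1\<^esub> h \<otimes>\<^bsub>G1\<^esub> inv\<^bsub>G1\<^esub> x \<in> Domain (edge G3 \<Delta>)"
    if "x \<in> carrier G1" "h \<in> Domain (edge G3 \<Delta>)" for x h
    using surj1[OF that(1)] that(2) unfolding Domain_iff mem_edge by (blast intro: conj)
  ultimately show "Domain (edge G3 \<Delta>) \<lhd> G1" by (simp add: G1.normal_inv_iff)
  have "subgroup (Range (edge G3 \<Delta>)) G2"
  proof (rule G2.subgroupI)
    show "Range (edge G3 \<Delta>) \<subseteq> carrier G2"
      using carr by auto
    show "Range (edge G3 \<Delta>) \<noteq> {}"
      using one by force
    show "inv\<^bsub>G2\<^esub> x \<in> Range (edge G3 \<Delta>)" if "x \<in> Range (edge G3 \<Delta>)" for x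
      using that minv1 by force
    show "x \<otimes>\<^bsub>G2\<^esub> y \<in> Range (edge G3 \<Delta>)"
      if "x \<in> Range (edge G3 \<Delta>)" "y \<in> Range (edge G3 \<Delta>)" for x y
      using that mult1 by force
  qed
  moreover have "x \<otimes>\<^bsub>G2\<^esub> h \<otimes>\<^bsub>G2\<^esub> inv\<^bsub>G2\<^esub> x \<in> Range (edge G3 \<Delta>)"
    if "x \<in> carrier G2" "h \<in> Range (edge G3 \<Delta>)" for x h
    using surj2[OF that(1)] that(2) unfolding Range_iff mem_edge by (blast intro: conj)
  ultimately show "Range (edge G3 \<Delta>) \<lhd> G2" by (simp add: G2.normal_inv_iff)
qed

end

context split_triple
begin

interpretation R: split_triple G2 G3 G1 "rotate3 \<Delta>" by (rule split_rotated)
interpretation RR: split_triple G3 G1 G2 "rotate3 (rotate3 \<Delta>)" by (rule R.split_rotated)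

text \<open>Reading off the first coordinate of a member of \<open>edges_factor\<close> writes each
  \<open>x\<close> in \<open>G1\<close> as a product of an element of \<open>B1\<close> and one of
  \<open>C1\<close>; \<open>edges_commute\<close> makes the two subgroups commute.\<close>

lemma central_factorization_edges:
  "central_factorization G1 (Domain (edge G3 \<Delta>)) (Range (edge G2 (rotate3 (rotate3 \<Delta>))))"
  unfolding central_factorization_def
proof (intro conjI ballI)
  show "Domain (edge G3 \<Delta>) <#>\<^bsub>G1\<^esub> Range (edge G2 (rotate3 (rotate3 \<Delta>))) = carrier G1"
  proof
    show "carrier G1 \<subseteq> Domain (edge G3 \<Delta>) <#>\<^bsub>G1\<^esub> Range (edge G2 (rotate3 (rotate3 \<Delta>)))"
    proof
      fix x assume "x \<in> carrier G1"
      then obtain y z where "(x, y, z) \<in> edges_factor G1 G2 G3 \<Delta>" using surj1 factor by blast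
      then obtain a a' c c' where x: "x = a \<otimes>\<^bsub>G1\<^esub> c'"
        and "(a, a', \<one>\<^bsub>G3\<^esub>) \<in> \<Delta>" "(c', \<one>\<^bsub>G2\<^esub>, c) \<in> \<Delta>"
        unfolding edges_factor_def by blast
      then have "a \<in> Domain (edge G3 \<Delta>)" "c' \<in> Range (edge G2 (rotate3 (rotate3 \<Delta>)))"
        by auto
      with x show "x \<in> Domain (edge G3 \<Delta>) <#>\<^bsub>G1\<^esub> Range (edge G2 (rotate3 (rotate3 \<Delta>)))"
        unfolding set_mult_def by blast
    qed
  qed (auto simp: set_mult_def dest!: carr)
qed (use normal_Domain_edge RR.normal_Range_edge edges_commute in auto)

text \<open>Dividing \<open>(x, y, 1)\<close> by \<open>(x, 1, z)\<close> leaves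
  \<open>(1, y, inv z)\<close>, and dividing by the latter leads back. Membership of
  \<open>z\<close> in the carrier is what makes its double inverse equal to
  \<open>z\<close>.\<close>

lemma edge_triangle:
  assumes "(x, y, \<one>\<^bsub>G3\<^esub>) \<in> \<Delta>"
  shows "(x, \<one>\<^bsub>G2\<^esub>, z) \<in> \<Delta> \<longleftrightarrow> (\<one>\<^bsub>G1\<^esub>, y, inv\<^bsub>G3\<^esub> z) \<in> \<Delta> \<and> z \<in> carrier G3"
proof
  assume "(x, \<one>\<^bsub>G2\<^esub>, z) \<in> \<Delta>"
  then show "(\<one>\<^bsub>G1\<^esub>, y, inv\<^bsub>G3\<^esub> z) \<in> \<Delta> \<and> z \<in> carrier G3"
    using mult[OF assms minv, of x "\<one>\<^bsub>G2\<^esub>" z] carr[OF assms] carr[of x "\<one>\<^bsub>G2\<^esub>" z] by simp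
next
  assume h: "(\<one>\<^bsub>G1\<^esub>, y, inv\<^bsub>G3\<^esub> z) \<in> \<Delta> \<and> z \<in> carrier G3"
  then show "(x, \<one>\<^bsub>G2\<^esub>, z) \<in> \<Delta>"
    using mult[OF assms minv, of "\<one>\<^bsub>G1\<^esub>" y "inv\<^bsub>G3\<^esub> z"] carr[OF assms] by simp
qed

text \<open>By \<open>edge_triangle\<close>, for \<open>(x, y, 1)\<close> in \<Delta> the entry
  \<open>x\<close> lies in \<open>C1\<close> exactly when \<open>y\<close> lies in
  \<open>B2\<close>, the two witnesses in \<open>G3\<close> being inverse to each other.\<close>

lemma graph_map_image_Int:
  "graph_map (edge G3 \<Delta>) ` (Domain (edge G3 \<Delta>) \<inter> Range (edge G2 (rotate3 (rotate3 \<Delta>)))) =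
     Domain (edge G1 (rotate3 \<Delta>)) \<inter> Range (edge G3 \<Delta>)" (is "_ ` ?S = ?T")
proof
  show "graph_map (edge G3 \<Delta>) ` ?S \<subseteq> ?T"
    by (auto simp: graph_map_edge edge_triangle)
  show "?T \<subseteq> graph_map (edge G3 \<Delta>) ` ?S"
  proof
    fix y assume "y \<in> ?T"
    then obtain x z where xz: "(x, y, \<one>\<^bsub>G3\<^esub>) \<in> \<Delta>" "(\<one>\<^bsub>G1\<^esub>, y, z) \<in> \<Delta>" by auto
    then have "(x, \<one>\<^bsub>G2\<^esub>, inv\<^bsub>G3\<^esub> z) \<in> \<Delta>"
      using edge_triangle[OF xz(1)] carr[OF xz(2)] by simp
    then show "y \<in> graph_map (edge G3 \<Delta>) ` ?S"
      using xz(1) by (intro image_eqI[of _ _ x]) (auto simp: graph_map_edge)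
  qed
qed

lemma graph_map_cycle:
  assumes "x \<in> Domain (edge G3 \<Delta>) \<inter> Range (edge G2 (rotate3 (rotate3 \<Delta>)))"
  shows "graph_map (edge G2 (rotate3 (rotate3 \<Delta>))) (graph_map (edge G1 (rotate3 \<Delta>))
    (graph_map (edge G3 \<Delta>) x)) = inv\<^bsub>G1\<^esub> x"
proof -
  obtain y z where xyz: "(x, y, \<one>\<^bsub>G3\<^esub>) \<in> \<Delta>" "(x, \<one>\<^bsub>G2\<^esub>, z) \<in> \<Delta>"
    using assms by auto
  \<comment> \<open>The three values along the cycle: \<open>x\<close> goes to \<open>y\<close>,
    then to \<open>inv z\<close>, and the inverse of \<open>(x, 1, z)\<close> shows that this goes
    to \<open>inv x\<close>.\<close>
  then have "(\<one>\<^bsub>G1\<^esub>, y, inv\<^bsub>G3\<^esub> z) \<in> \<Delta>" "(inv\<^bsub>G1\<^esub> x, \<one>\<^bsub>G2\<^esub>, inv\<^bsub>G3\<^esub> z) \<in> \<Delta>"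
    using edge_triangle minv[OF xyz(2)] by auto
  then show ?thesis
    using xyz by (simp add: graph_map_edge R.graph_map_edge RR.graph_map_edge)
qed

lemma graph_map_edge_iff:
  "(x, y, \<one>\<^bsub>G3\<^esub>) \<in> \<Delta> \<longleftrightarrow> x \<in> Domain (edge G3 \<Delta>) \<and> y = graph_map (edge G3 \<Delta>) x"
  by (auto simp: graph_map_edge)

end

section \<open>The correspondence lands in the tuples and is injective\<close>

lemma (in split_triple) gluing_data_in_tuples:
  "gluing_data_of G1 G2 G3 \<Delta> \<in> gluing_tuples G1 G2 G3"
proof -
  interpret R: split_triple G2 G3 G1 "rotate3 \<Delta>" by (rule split_rotated)
  interpret RR: split_triple G3 G1 G2 "rotate3 (rotate3 \<Delta>)" by (rule R.split_rotated)
  show ?thesis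
    \<comment> \<open>The conditions for the three indices are one statement and its two rotations;
      the cycle condition is stated over \<open>B1\<close> only.\<close>
    using central_factorization_edges R.central_factorization_edges RR.central_factorization_edges
      edge_iso R.edge_iso RR.edge_iso
      graph_map_image_Int R.graph_map_image_Int RR.graph_map_image_Int graph_map_cycle
    unfolding gluing_data_of_edge gluing_tuples_def Let_def by simp
qed

text \<open>Domain and map recover each edge as a graph, and the three edges recover \<Delta>
  through \<open>factor\<close>.\<close>

lemma gluing_data_inj:
  assumes "split_triple G1 G2 G3 \<Delta>" "split_triple G1 G2 G3 \<Delta>'"
    and eq: "gluing_data_of G1 G2 G3 \<Delta> = gluing_data_of G1 G2 G3 \<Delta>'"
  shows "\<Delta> = \<Delta>'"
proof -
  interpret A: split_triple G1 G2 G3 \<Delta> by fact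
  interpret AR: split_triple G2 G3 G1 "rotate3 \<Delta>" by (rule A.split_rotated)
  interpret ARR: split_triple G3 G1 G2 "rotate3 (rotate3 \<Delta>)" by (rule AR.split_rotated)
  interpret B: split_triple G1 G2 G3 \<Delta>' by fact
  interpret BR: split_triple G2 G3 G1 "rotate3 \<Delta>'" by (rule B.split_rotated)
  interpret BRR: split_triple G3 G1 G2 "rotate3 (rotate3 \<Delta>')" by (rule BR.split_rotated)
  have eqs:
    "Domain (edge G3 \<Delta>) = Domain (edge G3 \<Delta>')"
    "Domain (edge G1 (rotate3 \<Delta>)) = Domain (edge G1 (rotate3 \<Delta>'))"
    "Domain (edge G2 (rotate3 (rotate3 \<Delta>))) = Domain (edge G2 (rotate3 (rotate3 \<Delta>')))"
    "graph_map (edge G3 \<Delta>) = graph_map (edge G3 \<Delta>')"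
    "graph_map (edge G1 (rotate3 \<Delta>)) = graph_map (edge G1 (rotate3 \<Delta>'))"
    "graph_map (edge G2 (rotate3 (rotate3 \<Delta>))) = graph_map (edge G2 (rotate3 (rotate3 \<Delta>')))"
    using eq unfolding gluing_data_of_edge Let_def by simp_all
  have "(x, y, \<one>\<^bsub>G3\<^esub>) \<in> \<Delta> \<longleftrightarrow> (x, y, \<one>\<^bsub>G3\<^esub>) \<in> \<Delta>'" for x y
    by (simp only: A.graph_map_edge_iff B.graph_map_edge_iff eqs)
  moreover have "(y, z, \<one>\<^bsub>G1\<^esub>) \<in> rotate3 \<Delta> \<longleftrightarrow> (y, z, \<one>\<^bsub>G1\<^esub>) \<in> rotate3 \<Delta>'" for y z
    by (simp only: AR.graph_map_edge_iff BR.graph_map_edge_iff eqs)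
  moreover have "(z, x, \<one>\<^bsub>G2\<^esub>) \<in> rotate3 (rotate3 \<Delta>) \<longleftrightarrow> (z, x, \<one>\<^bsub>G2\<^esub>) \<in> rotate3 (rotate3 \<Delta>')" for z x
    by (simp only: ARR.graph_map_edge_iff BRR.graph_map_edge_iff eqs)
  ultimately have "edges_factor G1 G2 G3 \<Delta> = edges_factor G1 G2 G3 \<Delta>'"
    by (simp add: edges_factor_def)
  then show ?thesis by (rule trans[OF A.factor trans[OF _ B.factor[symmetric]]])
qed

section \<open>Building a subdirect product from a tuple\<close>

locale gluing = G1: group G1 + G2: group G2 + G3: group G3
  for G1 :: "('a, 'm) monoid_scheme" and G2 :: "('b, 'n) monoid_scheme"
    and G3 :: "('c, 'k) monoid_scheme" +
  fixes B1 B2 B3 C1 C2 C3 f1 f2 f3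
  assumes cf1: "central_factorization G1 B1 C1"
    and cf2: "central_factorization G2 B2 C2"
    and cf3: "central_factorization G3 B3 C3"
    and iso1: "subgroup_iso G1 B1 G2 C2 f1"
    and iso2: "subgroup_iso G2 B2 G3 C3 f2"
    and iso3: "subgroup_iso G3 B3 G1 C1 f3"
    and int1: "f1 ` (B1 \<inter> C1) = B2 \<inter> C2"
    and int2: "f2 ` (B2 \<inter> C2) = B3 \<inter> C3"
    and int3: "f3 ` (B3 \<inter> C3) = B1 \<inter> C1"
    and cycle: "\<forall>x\<in>B1 \<inter> C1. f3 (f2 (f1 x)) = inv\<^bsub>G1\<^esub> x"

text \<open>What \<open>edges_factor\<close> becomes when the three edges are the graphs of
  \<open>f1\<close>, \<open>f2\<close> and \<open>f3\<close>; the cyclic pattern of factors is the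
  same.\<close>

definition glue ::
  "('a, 'm) monoid_scheme \<Rightarrow> ('b, 'n) monoid_scheme \<Rightarrow> ('c, 'k) monoid_scheme
    \<Rightarrow> 'a set \<Rightarrow> 'b set \<Rightarrow> 'c set \<Rightarrow> ('a \<Rightarrow> 'b) \<Rightarrow> ('b \<Rightarrow> 'c) \<Rightarrow> ('c \<Rightarrow> 'a) \<Rightarrow> ('a \<times> 'b \<times> 'c) set" where
  "glue G1 G2 G3 B1 B2 B3 f1 f2 f3 =
     {(a \<otimes>\<^bsub>G1\<^esub> f3 c, b \<otimes>\<^bsub>G2\<^esub> f1 a, c \<otimes>\<^bsub>G3\<^esub> f2 b) | a b c. a \<in> B1 \<and> b \<in> B2 \<and> c \<in> B3}"

lemma rotate3_glue:
  "rotate3 (glue G1 G2 G3 B1 B2 B3 f1 f2 f3) = glue G2 G3 G1 B2 B3 B1 f2 f3 f1"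
  unfolding glue_def rotate3_def by blast

context gluing
begin

lemma subgroups: "subgroup B1 G1" "subgroup C1 G1" "subgroup B2 G2" "subgroup C2 G2"
  using cf1 cf2 by (auto simp: central_factorization_def normal_imp_subgroup)

lemma commute: "b \<in> B1 \<Longrightarrow> c \<in> C1 \<Longrightarrow> b \<otimes>\<^bsub>G1\<^esub> c = c \<otimes>\<^bsub>G1\<^esub> b"
  using cf1 unfolding central_factorization_def by blast

lemma f_closed: "b \<in> B1 \<Longrightarrow> f1 b \<in> C2"
  and f_mult: "b \<in> B1 \<Longrightarrow> b' \<in> B1 \<Longrightarrow> f1 (b \<otimes>\<^bsub>G1\<^esub> b') = f1 b \<otimes>\<^bsub>G2\<^esub> f1 b'"
  and f_bij: "bij_betw f1 B1 C2"
proof -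
  have h: "f1 \<in> hom (G1\<lparr>carrier := B1\<rparr>) (G2\<lparr>carrier := C2\<rparr>)" and bij: "bij_betw f1 B1 C2"
    using iso1 by (simp_all add: subgroup_iso_def iso_def)
  show "f1 b \<in> C2" if "b \<in> B1" using bij that by (rule bij_betw_apply)
  show "f1 (b \<otimes>\<^bsub>G1\<^esub> b') = f1 b \<otimes>\<^bsub>G2\<^esub> f1 b'" if "b \<in> B1" "b' \<in> B1"
    using hom_mult[OF h] that by simp
qed (use iso1 in \<open>simp add: subgroup_iso_def iso_def\<close>)

lemma f_one: "f1 \<one>\<^bsub>G1\<^esub> = \<one>\<^bsub>G2\<^esub>"
proof -
  have "\<one>\<^bsub>G1\<^esub> \<in> B1" using subgroups(1) by (rule subgroup.one_closed)
  then have "f1 \<one>\<^bsub>G1\<^esub> \<in> carrier G2" "f1 \<one>\<^bsub>G1\<^esub> \<otimes>\<^bsub>G2\<^esub> f1 \<one>\<^bsub>G1\<^esub> = f1 \<one>\<^bsub>G1\<^esub>"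
    using f_mult[of "\<one>\<^bsub>G1\<^esub>" "\<one>\<^bsub>G1\<^esub>"] subgroup.mem_carrier[OF subgroups(4) f_closed] by simp_all
  then show ?thesis by simp
qed

lemma f_inv:
  assumes "b \<in> B1"
  shows "f1 (inv\<^bsub>G1\<^esub> b) = inv\<^bsub>G2\<^esub> f1 b"
proof -
  have b: "b \<in> carrier G1" "inv\<^bsub>G1\<^esub> b \<in> B1"
    using assms subgroups(1) by (simp_all add: subgroup.mem_carrier subgroup.m_inv_closed)
  then have "f1 (inv\<^bsub>G1\<^esub> b) \<otimes>\<^bsub>G2\<^esub> f1 b = \<one>\<^bsub>G2\<^esub>"
    using f_mult[OF b(2) assms] f_one by simp
  then show ?thesis
    using G2.inv_equality subgroup.mem_carrier[OF subgroups(4) f_closed] assms b(2) by simp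
qed

text \<open>Only the cycle condition needs an argument: it is carried from
  \<open>B1 \<inter> C1\<close> to \<open>B2 \<inter> C2\<close> along \<open>f1\<close>, which
  preserves inverses.\<close>

lemma gluing_rotated: "gluing G2 G3 G1 B2 B3 B1 C2 C3 C1 f2 f3 f1"
proof -
  have "\<forall>y\<in>B2 \<inter> C2. f1 (f3 (f2 y)) = inv\<^bsub>G2\<^esub> y"
  proof
    fix y assume "y \<in> B2 \<inter> C2"
    then obtain x where x: "x \<in> B1 \<inter> C1" "y = f1 x" using int1 by blast
    then have "f3 (f2 y) = inv\<^bsub>G1\<^esub> x" using cycle by blast
    with x show "f1 (f3 (f2 y)) = inv\<^bsub>G2\<^esub> y" using f_inv by simp
  qed
  then show ?thesis
    by unfold_locales (rule cf1 cf2 cf3 iso1 iso2 iso3 int1 int2 int3 | blast)+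
qed

end

context gluing
begin

interpretation R: gluing G2 G3 G1 B2 B3 B1 C2 C3 C1 f2 f3 f1 by (rule gluing_rotated)
interpretation RR: gluing G3 G1 G2 B3 B1 B2 C3 C1 C2 f3 f1 f2 by (rule R.gluing_rotated)

abbreviation (input) "\<Gamma> \<equiv> glue G1 G2 G3 B1 B2 B3 f1 f2 f3"

text \<open>The map taking \<open>(a, c)\<close> to the product of \<open>a\<close> and
  \<open>f3 c\<close> is multiplicative because \<open>f3 c\<close> lies in \<open>C1\<close> and so
  commutes with \<open>B1\<close>.\<close>

lemma coordinate_mult:
  assumes "a \<in> B1" "c \<in> B3" "a' \<in> B1" "c' \<in> B3"
  shows "(a \<otimes>\<^bsub>G1\<^esub> f3 c) \<otimes>\<^bsub>G1\<^esub> (a' \<otimes>\<^bsub>G1\<^esub> f3 c') = (a \<otimes>\<^bsub>G1\<^esub> a') \<otimes>\<^bsub>G1\<^esub> f3 (c \<otimes>\<^bsub>G3\<^esub> c')"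
proof -
  have cl: "a \<in> carrier G1" "a' \<in> carrier G1" "f3 c \<in> carrier G1" "f3 c' \<in> carrier G1"
    using assms RR.f_closed subgroups by (auto simp: subgroup.mem_carrier)
  have "(a \<otimes>\<^bsub>G1\<^esub> f3 c) \<otimes>\<^bsub>G1\<^esub> (a' \<otimes>\<^bsub>G1\<^esub> f3 c') = a \<otimes>\<^bsub>G1\<^esub> (f3 c \<otimes>\<^bsub>G1\<^esub> a') \<otimes>\<^bsub>G1\<^esub> f3 c'"
    using cl by (simp add: G1.m_assoc)
  also have "f3 c \<otimes>\<^bsub>G1\<^esub> a' = a' \<otimes>\<^bsub>G1\<^esub> f3 c"
    by (rule commute[OF assms(3) RR.f_closed[OF assms(2)], symmetric])
  finally show ?thesis
    using cl RR.f_mult assms by (simp add: G1.m_assoc)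
qed

lemma coordinate_inv:
  assumes "a \<in> B1" "c \<in> B3"
  shows "inv\<^bsub>G1\<^esub> (a \<otimes>\<^bsub>G1\<^esub> f3 c) = inv\<^bsub>G1\<^esub> a \<otimes>\<^bsub>G1\<^esub> f3 (inv\<^bsub>G3\<^esub> c)"
proof (rule G1.inv_equality)
  have "inv\<^bsub>G1\<^esub> a \<in> B1" "inv\<^bsub>G3\<^esub> c \<in> B3"
    using assms subgroups RR.subgroups by (auto simp: subgroup.m_inv_closed)
  then show "(inv\<^bsub>G1\<^esub> a \<otimes>\<^bsub>G1\<^esub> f3 (inv\<^bsub>G3\<^esub> c)) \<otimes>\<^bsub>G1\<^esub> (a \<otimes>\<^bsub>G1\<^esub> f3 c) = \<one>\<^bsub>G1\<^esub>"
    using coordinate_mult[of "inv\<^bsub>G1\<^esub> a" "inv\<^bsub>G3\<^esub> c" a c] assms subgroups RR.subgroups RR.f_one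
    by (simp add: subgroup.mem_carrier)
qed (use assms subgroups RR.f_closed RR.subgroups in \<open>auto simp: subgroup.mem_carrier subgroup.m_inv_closed\<close>)

lemma glue_carrier: "(x, y, z) \<in> \<Gamma> \<Longrightarrow> x \<in> carrier G1"
  unfolding glue_def using RR.f_closed subgroups by (auto simp: subgroup.mem_carrier)

text \<open>If the third coordinate is trivial, \<open>f2 b = inv c\<close> lies in
  \<open>B3 \<inter> C3\<close>, so \<open>b = f1 a'\<close> with \<open>a'\<close> in
  \<open>B1 \<inter> C1\<close>. The cycle condition yields \<open>f3 c = a'\<close>; hence both
  remaining coordinates absorb \<open>a'\<close> consistently, \<open>x\<close> being the product of
  \<open>a'\<close> and \<open>a\<close>, and \<open>y\<close> its image under
  \<open>f1\<close>.\<close>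

lemma glue_edge: "(x, y, \<one>\<^bsub>G3\<^esub>) \<in> \<Gamma> \<longleftrightarrow> x \<in> B1 \<and> y = f1 x"
proof
  assume "x \<in> B1 \<and> y = f1 x"
  moreover from this have "x \<in> carrier G1" "f1 x \<in> carrier G2"
    using f_closed subgroups by (auto simp: subgroup.mem_carrier)
  ultimately show "(x, y, \<one>\<^bsub>G3\<^esub>) \<in> \<Gamma>"
    \<comment> \<open>The parameters are \<open>a = x\<close> and \<open>b\<close>, \<open>c\<close>
      trivial.\<close>
    unfolding glue_def using subgroups RR.subgroups R.f_one RR.f_one
    by (intro CollectI exI[of _ x] exI[of _ "\<one>\<^bsub>G2\<^esub>"] exI[of _ "\<one>\<^bsub>G3\<^esub>"])
      (auto simp: subgroup.one_closed)
next
  assume "(x, y, \<one>\<^bsub>G3\<^esub>) \<in> \<Gamma>"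
  then obtain a b c where abc: "a \<in> B1" "b \<in> B2" "c \<in> B3"
    and x: "x = a \<otimes>\<^bsub>G1\<^esub> f3 c" and y: "y = b \<otimes>\<^bsub>G2\<^esub> f1 a" and z: "c \<otimes>\<^bsub>G3\<^esub> f2 b = \<one>\<^bsub>G3\<^esub>"
    unfolding glue_def by auto
  have C3: "f2 b \<in> C3" and cl: "c \<in> carrier G3" "f2 b \<in> carrier G3"
    using abc R.f_closed RR.subgroups by (auto simp: subgroup.mem_carrier)
  have c: "c = inv\<^bsub>G3\<^esub> f2 b" and "f2 b = inv\<^bsub>G3\<^esub> c"
    using z cl G3.inv_equality G3.inv_inv by metis+
  then have "f2 b \<in> B3 \<inter> C3"
    using abc C3 RR.subgroups by (auto simp: subgroup.m_inv_closed)
  then have "f2 b \<in> f2 ` (B2 \<inter> C2)" using int2 by simp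
  \<comment> \<open>Injectivity of \<open>f2\<close> on \<open>B2\<close> pulls membership in the
    intersection back from \<open>f2 b\<close> to \<open>b\<close>.\<close>
  moreover have "b \<in> B2 \<inter> C2 \<longleftrightarrow> f2 b \<in> f2 ` (B2 \<inter> C2)"
    using R.f_bij abc(2) by (auto simp: bij_betw_def inj_on_def)
  ultimately obtain a' where a': "a' \<in> B1 \<inter> C1" "b = f1 a'" using int1 by blast
  \<comment> \<open>\<open>c\<close> is the inverse of \<open>f2 b\<close>, and the cycle condition
    contributes a second inverse, so the two cancel. The identity in place of inversion would give
    \<open>inv a'\<close> here.\<close>
  have "f3 c = inv\<^bsub>G1\<^esub> (f3 (f2 b))"
    using RR.f_inv \<open>f2 b \<in> B3 \<inter> C3\<close> c by simp
  also have "\<dots> = a'"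
    using cycle a' subgroups by (simp add: subgroup.mem_carrier)
  finally have "x = a' \<otimes>\<^bsub>G1\<^esub> a" using x commute[of a a'] abc a' by simp
  then show "x \<in> B1 \<and> y = f1 x"
    using abc(1) a' y f_mult subgroup.m_closed[OF subgroups(1)] by simp
qed

end

context gluing
begin

interpretation R: gluing G2 G3 G1 B2 B3 B1 C2 C3 C1 f2 f3 f1 by (rule gluing_rotated)
interpretation RR: gluing G3 G1 G2 B3 B1 B2 C3 C1 C2 f3 f1 f2 by (rule R.gluing_rotated)

lemma glue_rotated:
  "glue G2 G3 G1 B2 B3 B1 f2 f3 f1 = rotate3 \<Gamma>"
  "glue G3 G1 G2 B3 B1 B2 f3 f1 f2 = rotate3 (rotate3 \<Gamma>)"
  by (simp_all only: rotate3_glue)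

lemma glue_edge2: "(\<one>\<^bsub>G1\<^esub>, y, z) \<in> \<Gamma> \<longleftrightarrow> y \<in> B2 \<and> z = f2 y"
  using R.glue_edge by (simp add: glue_rotated)

lemma glue_edge3: "(x, \<one>\<^bsub>G2\<^esub>, z) \<in> \<Gamma> \<longleftrightarrow> z \<in> B3 \<and> x = f3 z"
  using RR.glue_edge by (simp add: glue_rotated)

lemma slim_glue: "slim_triple G1 G2 G3 \<Gamma>"
proof
  show carr: "x \<in> carrier G1 \<and> y \<in> carrier G2 \<and> z \<in> carrier G3" if "(x, y, z) \<in> \<Gamma>" for x y z
    using that glue_carrier[of x y z] R.glue_carrier[of y z x] RR.glue_carrier[of z x y]
    by (simp add: glue_rotated)
  show "(\<one>\<^bsub>G1\<^esub>, \<one>\<^bsub>G2\<^esub>, \<one>\<^bsub>G3\<^esub>) \<in> \<Gamma>"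
    using glue_edge f_one subgroups by (simp add: subgroup.one_closed)
  show mult: "(x \<otimes>\<^bsub>G1\<^esub> x', y \<otimes>\<^bsub>G2\<^esub> y', z \<otimes>\<^bsub>G3\<^esub> z') \<in> \<Gamma>"
    if p: "(x, y, z) \<in> \<Gamma>" and q: "(x', y', z') \<in> \<Gamma>" for x y z x' y' z'
  proof -
    obtain a b c where abc: "a \<in> B1" "b \<in> B2" "c \<in> B3"
      "x = a \<otimes>\<^bsub>G1\<^esub> f3 c" "y = b \<otimes>\<^bsub>G2\<^esub> f1 a" "z = c \<otimes>\<^bsub>G3\<^esub> f2 b"
      using p unfolding glue_def by auto
    obtain a' b' c' where abc': "a' \<in> B1" "b' \<in> B2" "c' \<in> B3"
      "x' = a' \<otimes>\<^bsub>G1\<^esub> f3 c'" "y' = b' \<otimes>\<^bsub>G2\<^esub> f1 a'" "z' = c' \<otimes>\<^bsub>G3\<^esub> f2 b'"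
      using q unfolding glue_def by auto
    have "a \<otimes>\<^bsub>G1\<^esub> a' \<in> B1" "b \<otimes>\<^bsub>G2\<^esub> b' \<in> B2" "c \<otimes>\<^bsub>G3\<^esub> c' \<in> B3"
      using abc abc' subgroups RR.subgroups by (auto simp: subgroup.m_closed)
    moreover have "x \<otimes>\<^bsub>G1\<^esub> x' = (a \<otimes>\<^bsub>G1\<^esub> a') \<otimes>\<^bsub>G1\<^esub> f3 (c \<otimes>\<^bsub>G3\<^esub> c')"
      "y \<otimes>\<^bsub>G2\<^esub> y' = (b \<otimes>\<^bsub>G2\<^esub> b') \<otimes>\<^bsub>G2\<^esub> f1 (a \<otimes>\<^bsub>G1\<^esub> a')"
      "z \<otimes>\<^bsub>G3\<^esub> z' = (c \<otimes>\<^bsub>G3\<^esub> c') \<otimes>\<^bsub>G3\<^esub> f2 (b \<otimes>\<^bsub>G2\<^esub> b')"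
      using coordinate_mult R.coordinate_mult RR.coordinate_mult abc abc' by simp_all
    ultimately show ?thesis
      unfolding glue_def by blast
  qed
  show minv: "(inv\<^bsub>G1\<^esub> x, inv\<^bsub>G2\<^esub> y, inv\<^bsub>G3\<^esub> z) \<in> \<Gamma>" if p: "(x, y, z) \<in> \<Gamma>" for x y z
  proof -
    obtain a b c where abc: "a \<in> B1" "b \<in> B2" "c \<in> B3"
      "x = a \<otimes>\<^bsub>G1\<^esub> f3 c" "y = b \<otimes>\<^bsub>G2\<^esub> f1 a" "z = c \<otimes>\<^bsub>G3\<^esub> f2 b"
      using p unfolding glue_def by auto
    have "inv\<^bsub>G1\<^esub> a \<in> B1" "inv\<^bsub>G2\<^esub> b \<in> B2" "inv\<^bsub>G3\<^esub> c \<in> B3"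
      using abc subgroups RR.subgroups by (auto simp: subgroup.m_inv_closed)
    moreover have "inv\<^bsub>G1\<^esub> x = inv\<^bsub>G1\<^esub> a \<otimes>\<^bsub>G1\<^esub> f3 (inv\<^bsub>G3\<^esub> c)"
      "inv\<^bsub>G2\<^esub> y = inv\<^bsub>G2\<^esub> b \<otimes>\<^bsub>G2\<^esub> f1 (inv\<^bsub>G1\<^esub> a)"
      "inv\<^bsub>G3\<^esub> z = inv\<^bsub>G3\<^esub> c \<otimes>\<^bsub>G3\<^esub> f2 (inv\<^bsub>G2\<^esub> b)"
      using coordinate_inv R.coordinate_inv RR.coordinate_inv abc by simp_all
    ultimately show ?thesis
      unfolding glue_def by blast
  qed
  \<comment> \<open>Two elements agreeing in two coordinates have a quotient that is trivial there.
    The edge descriptions make its remaining coordinate the image of a unit, hence trivial.\<close>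
  have quot: "(x \<otimes>\<^bsub>G1\<^esub> inv\<^bsub>G1\<^esub> x', y \<otimes>\<^bsub>G2\<^esub> inv\<^bsub>G2\<^esub> y', z \<otimes>\<^bsub>G3\<^esub> inv\<^bsub>G3\<^esub> z') \<in> \<Gamma>"
    if "(x, y, z) \<in> \<Gamma>" "(x', y', z') \<in> \<Gamma>" for x y z x' y' z'
    using mult[OF that(1) minv[OF that(2)]] .
  show "x = x'" if p: "(x, y, z) \<in> \<Gamma>" "(x', y, z) \<in> \<Gamma>" for x y z x'
    using quot[OF p] carr[OF p(1)] carr[OF p(2)] RR.f_one
    by (simp add: glue_edge3 G1.inv_solve_right')
  show "y = y'" if p: "(x, y, z) \<in> \<Gamma>" "(x, y', z) \<in> \<Gamma>" for x y z y'
    using quot[OF p] carr[OF p(1)] carr[OF p(2)] f_one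
    by (simp add: glue_edge G2.inv_solve_right')
  show "z = z'" if p: "(x, y, z) \<in> \<Gamma>" "(x, y, z') \<in> \<Gamma>" for x y z z'
    using quot[OF p] carr[OF p(1)] carr[OF p(2)] R.f_one
    by (simp add: glue_edge2 G3.inv_solve_right')
qed

text \<open>Splitting \<open>x\<close> along \<open>B1\<close> and \<open>C1\<close> gives
  \<open>a\<close>, and \<open>c\<close> through the surjectivity of \<open>f3\<close>; the free
  parameter \<open>b\<close> is set to the unit.\<close>

lemma glue_surj:
  assumes "x \<in> carrier G1"
  shows "\<exists>y z. (x, y, z) \<in> \<Gamma>"
proof -
  obtain a c' where "a \<in> B1" "c' \<in> C1" "x = a \<otimes>\<^bsub>G1\<^esub> c'"
    using assms cf1 unfolding central_factorization_def set_mult_def by blast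
  moreover from this obtain c where "c \<in> B3" "c' = f3 c"
    using RR.f_bij by (auto simp: bij_betw_def)
  ultimately show ?thesis
    unfolding glue_def using subgroup.one_closed[OF subgroups(3)] by blast
qed

end

context gluing
begin

lemma split_glue: "split_triple G1 G2 G3 \<Gamma>"
proof -
  interpret R: gluing G2 G3 G1 B2 B3 B1 C2 C3 C1 f2 f3 f1 by (rule gluing_rotated)
  interpret RR: gluing G3 G1 G2 B3 B1 B2 C3 C1 C2 f3 f1 f2 by (rule R.gluing_rotated)
  interpret slim_triple G1 G2 G3 \<Gamma> by (rule slim_glue)
  show ?thesis
  proof
    show "\<exists>y z. (x, y, z) \<in> \<Gamma>" if "x \<in> carrier G1" for x
      using glue_surj[OF that] .
    show "\<exists>x z. (x, y, z) \<in> \<Gamma>" if "y \<in> carrier G2" for y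
      using R.glue_surj[OF that] by (auto simp: glue_rotated)
    show "\<exists>x y. (x, y, z) \<in> \<Gamma>" if "z \<in> carrier G3" for z
      using RR.glue_surj[OF that] by (auto simp: glue_rotated)
    show "\<Gamma> = edges_factor G1 G2 G3 \<Gamma>"
      \<comment> \<open>The edge descriptions force \<open>a' = f1 a\<close>,
        \<open>b' = f2 b\<close> and \<open>c' = f3 c\<close>, which is the parametrization in
        \<open>glue\<close>.\<close>
      unfolding edges_factor_def glue_edge glue_edge2 glue_edge3 by (auto simp: glue_def)
  qed
qed

text \<open>The edges of \<Gamma> are the graphs of the given maps. Extensionality is what makes
  \<open>graph_map\<close> return those very functions and not just maps agreeing with them on the
  domains.\<close>

lemma gluing_data_of_glue:
  "gluing_data_of G1 G2 G3 \<Gamma> = (B1, B2, B3, C1, C2, C3, f1, f2, f3)"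
proof -
  interpret R: gluing G2 G3 G1 B2 B3 B1 C2 C3 C1 f2 f3 f1 by (rule gluing_rotated)
  interpret RR: gluing G3 G1 G2 B3 B1 B2 C3 C1 C2 f3 f1 f2 by (rule R.gluing_rotated)
  have graph: "Domain {(x, y). x \<in> B \<and> y = f x} = B"
    "f \<in> extensional B \<Longrightarrow> graph_map {(x, y). x \<in> B \<and> y = f x} = f"
    for f :: "'x \<Rightarrow> 'y" and B
    by (auto simp: graph_map_def fun_eq_iff extensional_def)
  have "edge G3 \<Gamma> = {(x, y). x \<in> B1 \<and> y = f1 x}"
    "edge G1 (rotate3 \<Gamma>) = {(x, y). x \<in> B2 \<and> y = f2 x}"
    "edge G2 (rotate3 (rotate3 \<Gamma>)) = {(x, y). x \<in> B3 \<and> y = f3 x}"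
    by (auto simp: glue_edge glue_edge2 glue_edge3)
  moreover have "f1 ` B1 = C2" "f2 ` B2 = C3" "f3 ` B3 = C1"
    using f_bij R.f_bij RR.f_bij by (auto simp: bij_betw_def)
  moreover have "f1 \<in> extensional B1" "f2 \<in> extensional B2" "f3 \<in> extensional B3"
    using iso1 iso2 iso3 by (auto simp: subgroup_iso_def)
  ultimately show ?thesis
    by (simp add: gluing_data_of_edge Let_def graph) blast
qed

end

text \<open>For surjectivity, \<open>glue\<close> supplies an explicit preimage of each
  tuple.\<close>

theorem theorem3p11:
  fixes G1 :: "('a, 'm) monoid_scheme"
    and G2 :: "('b, 'n) monoid_scheme"
    and G3 :: "('c, 'k) monoid_scheme"
  assumes "group G1" and "group G2" and "group G3"
  shows "bij_betw (gluing_data_of G1 G2 G3) (H_subdirect_products G1 G2 G3) (gluing_tuples G1 G2 G3)"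
proof (rule bij_betw_imageI)
  note iff = H_subdirect_products_iff[OF assms]
  show "inj_on (gluing_data_of G1 G2 G3) (H_subdirect_products G1 G2 G3)"
    by (rule inj_onI) (simp only: iff, rule gluing_data_inj)
  show "gluing_data_of G1 G2 G3 ` H_subdirect_products G1 G2 G3 = gluing_tuples G1 G2 G3"
  proof
    show "gluing_data_of G1 G2 G3 ` H_subdirect_products G1 G2 G3 \<subseteq> gluing_tuples G1 G2 G3"
      by (auto simp: iff intro: split_triple.gluing_data_in_tuples)
    show "gluing_tuples G1 G2 G3 \<subseteq> gluing_data_of G1 G2 G3 ` H_subdirect_products G1 G2 G3"
    proof
      fix t assume t: "t \<in> gluing_tuples G1 G2 G3"
      obtain B1 B2 B3 C1 C2 C3 f1 f2 f3 where t_eq: "t = (B1, B2, B3, C1, C2, C3, f1, f2, f3)"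
        by (metis surj_pair)
      interpret gluing G1 G2 G3 B1 B2 B3 C1 C2 C3 f1 f2 f3
        using t assms unfolding t_eq gluing_tuples_def gluing_def gluing_axioms_def by simp
      show "t \<in> gluing_data_of G1 G2 G3 ` H_subdirect_products G1 G2 G3"
        unfolding t_eq using gluing_data_of_glue split_glue iff by (metis image_eqI)
    qed
  qed
qed

end
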